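(* Let $k\ge1$ be fixed, let $T$ be a tree with $k$ edges, and let $v$ be a vertex of $T$. Let $E,F\subseteq\mathbb R^2$ be finite sets with $|E|=|F|=n$ ($n$ large), and suppose that every line through the origin contains at most $n^{2/3}$ points of $E$. Then there is a subset $E'\subseteq E$ with $|E'|\ge 2^{-k}n-o(n)$ such that for every $x\in E'$, the number of distinct $k$-tuples $\vec w\in\mathbb R^k$ for which there is a copy of $T_{\vec w}$ pinned at $x$ with its remaining vertices in $F$ is $\gtrsim n^{2k/3}$. Here the implied constant depends only on $k$.
   Context: Write the vertices of $T$ as $v_1,\dots,v_{k+1}$ and list its edges in a fixed order $e_1,\dots,e_k$. For $\vec w=(\alpha_1,\dots,\alpha_k)$, $T_{\vec w}$ is $T$ with weight $\alpha_j$ on $e_j$. A copy of $T_{\vec w}$ pinned at $x$ with remaining vertices in $F$ is an injective map $\varphi$ from the vertex set of $T$ to $\mathbb R^2$ satisfying three conditions: $\varphi(v)=x$; $\varphi(u)\in F$ for every vertex $u\ne v$; and $\varphi(v_a)\cdot\varphi(v_b)=\alpha_j$ whenever $e_j=\{v_a,v_b\}$ (standard dot product). The notation $X\gtrsim Y$ means $X\ge cY$ for some constant $c>0$. *)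

theory Defs
  imports "HOL-Analysis.Analysis" "HOL-Library.Landau_Symbols"
begin

text \<open>
  Finite simple graphs are given by a vertex set \<open>V\<close> and a set \<open>Es\<close> of edges, each edge being
  an unordered pair of distinct vertices.
\<close>

definition simple_graph :: "'a set \<Rightarrow> 'a set set \<Rightarrow> bool" where
  "simple_graph V Es \<longleftrightarrow> finite V \<and> (\<forall>e\<in>Es. \<exists>a\<in>V. \<exists>b\<in>V. a \<noteq> b \<and> e = {a, b})"

definition graph_connected :: "'a set \<Rightarrow> 'a set set \<Rightarrow> bool" where
  "graph_connected V Es \<longleftrightarrow> V \<noteq> {} \<and> (\<forall>a\<in>V. \<forall>b\<in>V. (a, b) \<in> {(s, t). {s, t} \<in> Es}\<^sup>*)"

text \<open>A cycle is listed by its (at least three) distinct vertices in cyclic order.\<close>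

definition graph_cycle :: "'a set set \<Rightarrow> 'a list \<Rightarrow> bool" where
  "graph_cycle Es c \<longleftrightarrow> length c \<ge> 3 \<and> distinct c \<and>
     (\<forall>i<length c. {c ! i, c ! (Suc i mod length c)} \<in> Es)"

definition is_tree :: "'a set \<Rightarrow> 'a set set \<Rightarrow> bool" where
  "is_tree V Es \<longleftrightarrow> simple_graph V Es \<and> graph_connected V Es \<and> (\<nexists>c. graph_cycle Es c)"

text \<open>
  The edges are listed in a fixed order \<open>es\<close>, and \<open>w ! j\<close> is the weight of the edge \<open>es ! j\<close>.
  Only the values of \<open>\<phi>\<close> on \<open>V\<close> matter.
\<close>

definition pinned_copy ::
  "'a set \<Rightarrow> 'a set list \<Rightarrow> real list \<Rightarrow> 'a \<Rightarrow> real^2 \<Rightarrow> (real^2) set \<Rightarrow> ('a \<Rightarrow> real^2) \<Rightarrow> bool" where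
  "pinned_copy V es w v x F \<phi> \<longleftrightarrow>
     inj_on \<phi> V \<and> \<phi> v = x \<and> (\<forall>u\<in>V - {v}. \<phi> u \<in> F) \<and>
     (\<forall>j<length es. \<forall>a b. es ! j = {a, b} \<longrightarrow> \<phi> a \<bullet> \<phi> b = w ! j)"

definition pinned_weights ::
  "'a set \<Rightarrow> 'a set list \<Rightarrow> 'a \<Rightarrow> real^2 \<Rightarrow> (real^2) set \<Rightarrow> real list set" where
  "pinned_weights V es v x F =
     {w. length w = length es \<and> (\<exists>\<phi>. pinned_copy V es w v x F \<phi>)}"

end

(*
  A pin x sorts F into lines orthogonal to x, one for each dot product, so pins on a common line
  through the origin have the same number of dot products with F.  If r directions each cut F into
  at most t lines, joining consecutive points along these lines gives a drawing with about r |F|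
  edges and at most (r t)^2 crossings, and the crossing lemma yields r |F| <= 576 t^2
  (Szemeredi-Trotter for parallel families).  Taking t of order n^(2/3) leaves O(n^(1/3))
  bad directions with a small constant, each carrying at most n^(2/3) bad pins of E; on a line
  through the origin F itself has at most t bad pins, because such a pin separates the points of
  that line.  Hence one may pass k times from F to its rich pins and lose only a fraction of the
  points.  Adding the leaves of the tree one at a time, each in the next larger of these nested
  sets, multiplies the number of weight tuples by at least t/2 in every step.
*)

theory Submission
  imports Defs
begin

subsection \<open>Plane graphs\<close>

text \<open>An edge is a segment stored as the pair of its ends, the left end first wherever it is
  used. Slope and height refer to the whole supporting line, while \<open>over\<close> confines
  abscissae to the open segment.\<close>

definition edge_slope :: "(real \<times> real) \<times> (real \<times> real) \<Rightarrow> real" where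
  "edge_slope e = (snd (snd e) - snd (fst e)) / (fst (snd e) - fst (fst e))"

definition edge_height :: "(real \<times> real) \<times> (real \<times> real) \<Rightarrow> real \<Rightarrow> real" where
  "edge_height e x = snd (fst e) + edge_slope e * (x - fst (fst e))"

definition over :: "real \<Rightarrow> (real \<times> real) \<times> (real \<times> real) \<Rightarrow> bool" where
  "over x e \<longleftrightarrow> fst (fst e) < x \<and> x < fst (snd e)"

lemma edge_height_left [simp]: "edge_height e (fst (fst e)) = snd (fst e)"
  by (simp add: edge_height_def)

lemma edge_height_right: "fst (fst e) < fst (snd e) \<Longrightarrow> edge_height e (fst (snd e)) = snd (snd e)"
  by (simp add: edge_height_def edge_slope_def)

lemma edge_height_diff: "edge_height e x - edge_height e y = edge_slope e * (x - y)"
  by (simp add: edge_height_def algebra_simps)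

lemma edge_height_meet:
  assumes "u < v" "edge_height e u < edge_height f u" "edge_height f v < edge_height e v"
  shows "\<exists>x. u < x \<and> x < v \<and> edge_height e x = edge_height f x"
proof -
  have "continuous_on {u..v} (\<lambda>x. edge_height e x - edge_height f x)"
    unfolding edge_height_def by (intro continuous_intros)
  then obtain x where x: "u \<le> x" "x \<le> v" "edge_height e x - edge_height f x = 0"
    using IVT'[of "\<lambda>x. edge_height e x - edge_height f x" u 0 v] assms by auto
  then have "x \<noteq> u" "x \<noteq> v" using assms by auto
  with x show ?thesis by (intro exI[of _ x]) auto
qed

text \<open>Distinct abscissae exclude vertical edges, so planarity can be tested one abscissa at a
  time. Only open edges are compared, hence edges may share ends.\<close>

locale plane_graph =
  fixes P :: "(real \<times> real) set" and N :: "((real \<times> real) \<times> (real \<times> real)) set"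
  assumes finite_P: "finite P"
    and inj_fst: "inj_on fst P"
    and edge_ends: "e \<in> N \<Longrightarrow> fst e \<in> P \<and> snd e \<in> P \<and> fst (fst e) < fst (snd e)"
    and vertex_off_edge: "e \<in> N \<Longrightarrow> z \<in> P \<Longrightarrow> over (fst z) e \<Longrightarrow> snd z \<noteq> edge_height e (fst z)"
    and noncrossing:
      "e \<in> N \<Longrightarrow> f \<in> N \<Longrightarrow> e \<noteq> f \<Longrightarrow> over x e \<Longrightarrow> over x f \<Longrightarrow> edge_height e x \<noteq> edge_height f x"
begin

lemma finite_N: "finite N"
proof (rule finite_subset)
  show "N \<subseteq> P \<times> P" using edge_ends by (metis mem_Times_iff subsetI)
qed (use finite_P in auto)

text \<open>Two edges whose vertical order changes over a common interval cross inside it, by the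
  intermediate value theorem.\<close>

lemma no_meet:
  assumes "e \<in> N" "f \<in> N" "u < v" "edge_height e u < edge_height f u" "edge_height f v < edge_height e v"
    and "fst (fst e) \<le> u" "fst (fst f) \<le> u" "v \<le> fst (snd e)" "v \<le> fst (snd f)"
  shows False
proof -
  obtain x where x: "u < x" "x < v" "edge_height e x = edge_height f x"
    using edge_height_meet assms by blast
  then show False
    using noncrossing[of e f x] assms by (auto simp: over_def)
qed

text \<open>Vertical ray shooting: \<open>e\<close> is the first edge hit when looking straight down
  from \<open>z\<close>. Each vertex has at most one such edge, which makes the charging of edges to
  vertices injective.\<close>

definition sees_below :: "real \<times> real \<Rightarrow> (real \<times> real) \<times> (real \<times> real) \<Rightarrow> bool" where
  "sees_below z e \<longleftrightarrow> over (fst z) e \<and> edge_height e (fst z) < snd z \<and>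
     (\<forall>g\<in>N. over (fst z) g \<longrightarrow> \<not> (edge_height e (fst z) < edge_height g (fst z) \<and> edge_height g (fst z) < snd z))"

text \<open>Edges leaving a vertex in the same direction overlap, as the abscissa midway to the
  nearer right end shows. Hence only one edge of maximal slope starts at a vertex.\<close>

lemma same_left_slope_eq:
  assumes "e \<in> N" "f \<in> N" "fst e = fst f" "edge_slope e = edge_slope f"
  shows "e = f"
proof (rule ccontr)
  assume "e \<noteq> f"
  define x where "x = (fst (fst e) + min (fst (snd e)) (fst (snd f))) / 2"
  have "over x e" "over x f"
    using edge_ends[OF assms(1)] edge_ends[OF assms(2)] assms(3) by (auto simp: over_def x_def min_def)
  moreover have "edge_height e x = edge_height f x"
    using assms by (simp add: edge_height_def)
  ultimately show False using noncrossing \<open>e \<noteq> f\<close> assms by blast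
qed

lemma edge_height_via_right:
  assumes "e \<in> N"
  shows "edge_height e x = snd (snd e) + edge_slope e * (x - fst (snd e))"
proof -
  have "edge_height e (fst (snd e)) = snd (snd e)"
    using edge_height_right edge_ends assms by blast
  with edge_height_diff[of e x "fst (snd e)"] show ?thesis by linarith
qed

lemma same_right_slope_eq:
  assumes "e \<in> N" "f \<in> N" "snd e = snd f" "edge_slope e = edge_slope f"
  shows "e = f"
proof (rule ccontr)
  assume "e \<noteq> f"
  define x where "x = (fst (snd e) + max (fst (fst e)) (fst (fst f))) / 2"
  have "over x e" "over x f"
    using edge_ends[OF assms(1)] edge_ends[OF assms(2)] assms(3) by (auto simp: over_def x_def max_def)
  moreover have "edge_height e x = edge_height f x"
    using assms by (simp add: edge_height_via_right)
  ultimately show False using noncrossing \<open>e \<noteq> f\<close> assms by blast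
qed

lemma sees_below_unique:
  assumes "e \<in> N" "f \<in> N" "sees_below z e" "sees_below z f"
  shows "e = f"
proof (rule ccontr)
  assume "e \<noteq> f"
  then have "edge_height e (fst z) \<noteq> edge_height f (fst z)"
    using noncrossing assms unfolding sees_below_def by blast
  then show False
    using assms unfolding sees_below_def by (meson linorder_neqE)
qed

text \<open>
  Let \<open>e'\<close> be the next edge above \<open>e\<close> at their common left end. The leftmost vertex in the wedge
  between them sees \<open>e\<close>: an edge blocking the view would have to start inside the wedge, further left.
\<close>

lemma exists_sees_below:
  assumes e: "e \<in> N"
    and left: "\<exists>f\<in>N. fst f = fst e \<and> edge_slope e < edge_slope f"
    and right: "\<exists>f\<in>N. snd f = snd e \<and> edge_slope f < edge_slope e"
  shows "\<exists>z\<in>P. sees_below z e"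
proof -
  define L where "L = {f\<in>N. fst f = fst e \<and> edge_slope e < edge_slope f}"
  have "finite L" using finite_N by (simp add: L_def)
  moreover have "L \<noteq> {}" using left unfolding L_def by blast
  ultimately obtain e' where e'L: "e' \<in> L" and e'min: "\<And>f. f \<in> L \<Longrightarrow> edge_slope e' \<le> edge_slope f"
    by (metis (no_types, lifting) arg_min_if_finite(1) arg_min_least)
  obtain e'' where e'': "e'' \<in> N" "snd e'' = snd e" "edge_slope e'' < edge_slope e"
    using right by blast
  have e': "e' \<in> N" "fst e' = fst e" "edge_slope e < edge_slope e'"
    using e'L by (auto simp: L_def)
  define a where "a = fst (fst e)"
  define b where "b = fst (snd e)"
  define q where "q = fst (snd e')"
  define r where "r = fst (fst e'')"
  have ab: "a < b" and aq: "a < q" and rb: "r < b"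
    using edge_ends[OF e] edge_ends[OF e'(1)] edge_ends[OF e''(1)] e' e''
    by (auto simp: a_def b_def q_def r_def)
  have up': "edge_height e x < edge_height e' x" if "a < x" for x
    using e' that by (simp add: edge_height_def a_def)
  \<comment> \<open>At a common right end the order is reversed: the edge of smaller slope lies
    higher.\<close>
  have up'': "edge_height e x < edge_height e'' x" if "x < b" for x
    using e'' that e by (simp add: edge_height_via_right b_def mult_strict_right_mono_neg)
  have ha: "edge_height e' a = edge_height e a" using e' by (simp add: edge_height_def a_def)
  have hb: "edge_height e'' b = edge_height e b" using e'' e by (simp add: edge_height_via_right b_def)
  have hq: "edge_height e' q = snd (snd e')"
    using e' by (simp add: edge_height_via_right q_def)
  have hr: "edge_height e'' r = snd (fst e'')"
    by (simp add: r_def)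
  \<comment> \<open>The wedge is closed above so that it contains the right end of \<open>e'\<close>
    when this lies over \<open>e\<close>.\<close>
  define Z where "Z = {z\<in>P. over (fst z) e \<and> edge_height e (fst z) < snd z \<and> snd z \<le> edge_height e' (fst z)}"
  have q_in: "snd e' \<in> Z" if "q < b"
    using that aq edge_ends[OF e'(1)] up'[OF aq] hq by (auto simp: Z_def over_def a_def b_def q_def)
  \<comment> \<open>If \<open>e'\<close> reaches at least as far right as \<open>e\<close>, then
    \<open>e''\<close> is below \<open>e'\<close> at the right end of \<open>e\<close>. It cannot
    have crossed \<open>e'\<close>, so it starts inside the wedge: a start at or left of
    \<open>a\<close> would put it above \<open>e'\<close> at \<open>a\<close>.\<close>
  have "Z \<noteq> {}"
  proof (cases "q < b")
    case True then show ?thesis using q_in by auto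
  next
    case False
    have b1: "edge_height e'' b < edge_height e' b" using up'[OF ab] hb by simp
    show ?thesis
    proof (cases "a < r")
      case True
      have "edge_height e'' r \<le> edge_height e' r"
      proof (rule ccontr)
        assume "\<not> ?thesis"
        with no_meet[OF e'(1) e''(1) rb] b1 True False e' e'' show False
          by (auto simp: a_def b_def q_def r_def)
      qed
      then have "fst e'' \<in> Z"
        using edge_ends[OF e''(1)] True rb up''[OF rb] hr by (auto simp: Z_def over_def a_def b_def r_def)
      then show ?thesis by auto
    next
      case False2: False
      with no_meet[OF e'(1) e''(1) ab] b1 ha up''[OF ab] False e' e'' have False
        by (auto simp: a_def b_def q_def r_def)
      then show ?thesis ..
    qed
  qed
  moreover have "finite Z" using finite_P by (simp add: Z_def)
  ultimately obtain z where z: "z \<in> Z" and zmin: "\<And>y. y \<in> Z \<Longrightarrow> fst z \<le> fst y"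
    by (metis (no_types, lifting) arg_min_if_finite(1) arg_min_least)
  have zP: "z \<in> P" and az: "a < fst z" and zb: "fst z < b"
    and ze: "edge_height e (fst z) < snd z" and ze': "snd z \<le> edge_height e' (fst z)"
    using z by (auto simp: Z_def over_def a_def b_def)
  have zq: "fst z \<le> q"
    using q_in zmin zb by (cases "q < b") (auto simp: q_def)
  have "\<not> (edge_height e (fst z) < edge_height g (fst z) \<and> edge_height g (fst z) < snd z)"
    if g: "g \<in> N" and og: "over (fst z) g" for g
  proof
    assume "edge_height e (fst z) < edge_height g (fst z) \<and> edge_height g (fst z) < snd z"
    then have ge: "edge_height e (fst z) < edge_height g (fst z)"
      and ge': "edge_height g (fst z) < edge_height e' (fst z)" using ze' by auto
    define c where "c = fst (fst g)"
    have cz: "c < fst z" and zd: "fst z < fst (snd g)" using og by (auto simp: over_def c_def)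
    have cP: "fst g \<in> P" using edge_ends g by blast
    \<comment> \<open>A blocking edge \<open>g\<close> that starts between \<open>a\<close> and
      \<open>z\<close> has its left end in the wedge, against the choice of \<open>z\<close>. One
      that starts further left is squeezed through the vertex \<open>fst e\<close>. One that starts
      at this vertex lies between \<open>e\<close> and \<open>e'\<close>, against the choice of
      \<open>e'\<close>.\<close>
    consider "a < c" | "c < a" | "c = a" by linarith
    then show False
    proof cases
      case 1
      have "edge_height g c \<noteq> edge_height e c"
        using vertex_off_edge[OF e cP] 1 cz zb by (simp add: c_def over_def a_def b_def)
      moreover have "\<not> edge_height g c < edge_height e c"
        using no_meet[OF g e cz] ge 1 zb zd by (auto simp: c_def a_def b_def)
      moreover have "\<not> edge_height e' c < edge_height g c"
        using no_meet[OF e'(1) g cz] ge' 1 zq zd e' by (auto simp: c_def a_def q_def)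
      ultimately have "fst g \<in> Z"
        using 1 cz zb cP by (auto simp: Z_def over_def a_def b_def c_def)
      from zmin[OF this] cz show False by (simp add: c_def)
    next
      case 2
      have "edge_height g a \<noteq> edge_height e a"
        using vertex_off_edge[OF g, of "fst e"] edge_ends[OF e] 2 az zd
        by (auto simp: over_def a_def c_def)
      moreover have "\<not> edge_height g a < edge_height e a"
        using no_meet[OF g e az] ge 2 zb zd by (auto simp: c_def a_def b_def)
      moreover have "\<not> edge_height e' a < edge_height g a"
        using no_meet[OF e'(1) g az] ge' 2 zq zd e' by (auto simp: c_def a_def q_def)
      ultimately show False using ha by simp
    next
      case 3
      then have ce: "fst g = fst e"
        using inj_fst cP edge_ends[OF e] by (auto simp: inj_on_def c_def a_def)
      have "edge_slope e < edge_slope g" "edge_slope g < edge_slope e'"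
        using ge ge' az ce e' by (auto simp: edge_height_def a_def)
      then show False using e'min[of g] g ce by (auto simp: L_def)
    qed
  qed
  then have "sees_below z e"
    using ze z by (auto simp: sees_below_def Z_def)
  then show ?thesis using zP by blast
qed

text \<open>
  An edge is charged to its left end if it is topmost there, to its right end if it is topmost there,
  and otherwise to a vertex that sees it vertically below.
\<close>

lemma card_edges_le: "card N \<le> 3 * card P"
proof -
  define N1 where "N1 = {e\<in>N. \<forall>f\<in>N. fst f = fst e \<longrightarrow> edge_slope f \<le> edge_slope e}"
  define N2 where "N2 = {e\<in>N. \<forall>f\<in>N. snd f = snd e \<longrightarrow> edge_slope e \<le> edge_slope f}"
  define N3 where "N3 = {e\<in>N. \<exists>z\<in>P. sees_below z e}"
  have sub: "N \<subseteq> N1 \<union> N2 \<union> N3"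
    using exists_sees_below by (fastforce simp: N1_def N2_def N3_def not_le)
  have c1: "card N1 \<le> card P"
  proof (rule card_inj_on_le[of fst])
    show "inj_on fst N1"
      by (rule inj_onI) (metis (mono_tags, lifting) N1_def mem_Collect_eq order_antisym same_left_slope_eq)
  qed (use edge_ends finite_P in \<open>auto simp: N1_def\<close>)
  have c2: "card N2 \<le> card P"
  proof (rule card_inj_on_le[of snd])
    show "inj_on snd N2"
      by (rule inj_onI) (metis (mono_tags, lifting) N2_def mem_Collect_eq order_antisym same_right_slope_eq)
  qed (use edge_ends finite_P in \<open>auto simp: N2_def\<close>)
  have "\<forall>e\<in>N3. \<exists>z\<in>P. sees_below z e" by (simp add: N3_def)
  then obtain \<zeta> where \<zeta>: "\<And>e. e \<in> N3 \<Longrightarrow> \<zeta> e \<in> P \<and> sees_below (\<zeta> e) e" by metis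
  have c3: "card N3 \<le> card P"
  proof (rule card_inj_on_le[of \<zeta>])
    show "inj_on \<zeta> N3"
      by (rule inj_onI) (metis (mono_tags, lifting) N3_def \<zeta> mem_Collect_eq sees_below_unique)
  qed (use \<zeta> finite_P in auto)
  have "card N \<le> card (N1 \<union> N2 \<union> N3)"
    using sub finite_N by (intro card_mono) (auto simp: N1_def N2_def N3_def)
  also have "\<dots> \<le> card N1 + card N2 + card N3"
    by (meson add_le_cancel_right card_Un_le le_trans)
  finally show ?thesis using c1 c2 c3 by linarith
qed

end

subsection \<open>Incidences between points and parallel lines\<close>

lemma sum_sampling_weights:
  fixes p :: real
  assumes "finite P" "A \<subseteq> P"
  shows "(\<Sum>R\<in>{R\<in>Pow P. A \<subseteq> R}. p ^ card R * (1 - p) ^ card (P - R)) = p ^ card A"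
proof -
  have fA: "finite A" using assms finite_subset by blast
  have "(\<Sum>R\<in>{R\<in>Pow P. A \<subseteq> R}. p ^ card R * (1 - p) ^ card (P - R)) =
        (\<Sum>B\<in>Pow (P - A). p ^ card A * (p ^ card B * (1 - p) ^ card (P - A - B)))"
  proof (rule sum.reindex_bij_witness[of _ "\<lambda>B. A \<union> B" "\<lambda>R. R - A"])
    fix R assume R: "R \<in> {R \<in> Pow P. A \<subseteq> R}"
    then have "finite R" using assms finite_subset by blast
    then have "card A + card (R - A) = card R"
      using R card_Int_Diff[of R A] by (simp add: Int_absorb1)
    moreover have "P - A - (R - A) = P - R" using R by blast
    ultimately show "p ^ card A * (p ^ card (R - A) * (1 - p) ^ card (P - A - (R - A))) = p ^ card R * (1 - p) ^ card (P - R)"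
      by (simp add: power_add[symmetric] mult.assoc[symmetric])
  qed (use assms in auto)
  \<comment> \<open>The sum over \<open>B\<close> expands a product of factors
    \<open>p + (1 - p)\<close>, all equal to 1.\<close>
  also have "\<dots> = p ^ card A * (\<Prod>x\<in>P - A. p + (1 - p))"
    unfolding prod_add[OF finite_Diff[OF assms(1)]] by (simp add: sum_distrib_left)
  finally show ?thesis by simp
qed

text \<open>Linearity of expectation for a random \<open>R\<close> that keeps each point
  independently with probability \<open>p\<close>: a configuration on \<open>c\<close> points
  survives with probability \<open>p ^ c\<close>.\<close>

lemma sum_sampling_card:
  fixes p :: real
  assumes "finite P" "finite I" and h: "\<And>i. i \<in> I \<Longrightarrow> h i \<subseteq> P \<and> card (h i) = c"
  shows "(\<Sum>R\<in>Pow P. p ^ card R * (1 - p) ^ card (P - R) * real (card {i\<in>I. h i \<subseteq> R})) = real (card I) * p ^ c"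
proof -
  let ?w = "\<lambda>R. p ^ card R * (1 - p) ^ card (P - R)"
  have "(\<Sum>R\<in>Pow P. ?w R * real (card {i\<in>I. h i \<subseteq> R})) =
        (\<Sum>R\<in>Pow P. \<Sum>i\<in>I. if h i \<subseteq> R then ?w R else 0)"
    using assms(2) by (intro sum.cong refl) (simp add: sum.If_cases Int_def mult.commute)
  also have "\<dots> = (\<Sum>i\<in>I. \<Sum>R\<in>Pow P. if h i \<subseteq> R then ?w R else 0)"
    by (rule sum.swap)
  also have "\<dots> = (\<Sum>i\<in>I. \<Sum>R\<in>{R\<in>Pow P. h i \<subseteq> R}. ?w R)"
    using assms(1) by (intro sum.cong refl sum.inter_filter[symmetric]) simp
  also have "\<dots> = (\<Sum>i\<in>I. p ^ c)"
    using sum_sampling_weights[OF assms(1)] h by (intro sum.cong refl) metis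
  finally show ?thesis by simp
qed

section \<open>Edges along parallel lines and their crossings\<close>

definition line_class :: "real \<Rightarrow> real \<times> real \<Rightarrow> real" where
  "line_class s z = snd z - s * fst z"

text \<open>The last condition makes the two ends consecutive among the points of \<open>P\<close>
  on their line.\<close>

definition line_edges :: "(real \<times> real) set \<Rightarrow> real set \<Rightarrow> ((real \<times> real) \<times> (real \<times> real)) set" where
  "line_edges P S = {e \<in> P \<times> P. fst (fst e) < fst (snd e) \<and> edge_slope e \<in> S \<and>
     (\<forall>z\<in>P. over (fst z) e \<longrightarrow> snd z \<noteq> edge_height e (fst z))}"

text \<open>Pairs are ordered, so every crossing is counted twice. Edges that merely meet at an end
  do not count.\<close>

definition crossings :: "(real \<times> real) set \<Rightarrow> real set \<Rightarrow>
    (((real \<times> real) \<times> (real \<times> real)) \<times> ((real \<times> real) \<times> (real \<times> real))) set" where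
  "crossings P S = {c \<in> line_edges P S \<times> line_edges P S. fst c \<noteq> snd c \<and>
     (\<exists>x. over x (fst c) \<and> over x (snd c) \<and> edge_height (fst c) x = edge_height (snd c) x)}"

lemma line_edgesD:
  assumes "e \<in> line_edges P S"
  shows "fst e \<in> P" "snd e \<in> P" "fst (fst e) < fst (snd e)" "edge_slope e \<in> S"
    "\<And>z. z \<in> P \<Longrightarrow> over (fst z) e \<Longrightarrow> snd z \<noteq> edge_height e (fst z)"
  using assms by (auto simp: line_edges_def)

lemma crossingsE:
  assumes "c \<in> crossings P S"
  obtains x where "fst c \<in> line_edges P S" "snd c \<in> line_edges P S" "fst c \<noteq> snd c"
    "over x (fst c)" "over x (snd c)" "edge_height (fst c) x = edge_height (snd c) x"
  using assms that unfolding crossings_def mem_Collect_eq mem_Times_iff by blast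

lemma edge_height_0: "edge_height e x = edge_slope e * x + edge_height e 0"
  using edge_height_diff[of e x 0] by simp

lemma edge_height_class: "edge_height e 0 = line_class (edge_slope e) (fst e)"
  by (simp add: edge_height_def line_class_def)

text \<open>The ends of an edge are consecutive points of their line, so neither edge has an end
  inside the other. Overlap then forces equal ends.\<close>

lemma same_line_overlap:
  assumes inj: "inj_on fst P" and e: "e \<in> line_edges P S" and f: "f \<in> line_edges P S"
    and same: "edge_slope e = edge_slope f" "edge_height e 0 = edge_height f 0"
    and x: "over x e" "over x f"
  shows "e = f"
proof -
  have h: "edge_height e y = edge_height f y" for y
    using same edge_height_0[of e y] edge_height_0[of f y] by simp
  have aux: "fst (fst e) \<ge> fst (fst f) \<and> fst (snd e) \<le> fst (snd f)"
    if e: "e \<in> line_edges P S" and f: "f \<in> line_edges P S" and h: "\<And>y. edge_height e y = edge_height f y"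
      and x: "over x e" "over x f" for e f
  proof (rule ccontr)
    assume "\<not> ?thesis"
    then consider "over (fst (fst f)) e" | "over (fst (snd f)) e"
      using x unfolding over_def by linarith
    then show False
    proof cases
      case 1
      then have "snd (fst f) \<noteq> edge_height e (fst (fst f))"
        using line_edgesD(5)[OF e] line_edgesD(1)[OF f] by blast
      then show False using h by simp
    next
      case 2
      then have "snd (snd f) \<noteq> edge_height e (fst (snd f))"
        using line_edgesD(5)[OF e] line_edgesD(2)[OF f] by blast
      moreover have "edge_height f (fst (snd f)) = snd (snd f)"
        using line_edgesD(3)[OF f] by (rule edge_height_right)
      ultimately show False using h by simp
    qed
  qed
  have "fst (fst e) = fst (fst f)" "fst (snd e) = fst (snd f)"
    using aux[OF e f h x] aux[OF f e h[symmetric] x(2,1)] by (simp_all add: order_antisym)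
  then have "fst e = fst f" "snd e = snd f"
    using inj line_edgesD(1,2)[OF e] line_edgesD(1,2)[OF f] by (simp_all add: inj_onD)
  then show ?thesis by (rule prod_eqI)
qed

lemma crossings_slope:
  assumes "inj_on fst P" "c \<in> crossings P S"
  shows "edge_slope (fst c) \<noteq> edge_slope (snd c)"
proof
  assume s: "edge_slope (fst c) = edge_slope (snd c)"
  obtain x where c: "fst c \<in> line_edges P S" "snd c \<in> line_edges P S" "fst c \<noteq> snd c"
    and x: "over x (fst c)" "over x (snd c)" "edge_height (fst c) x = edge_height (snd c) x"
    using assms(2) by (rule crossingsE)
  then have "edge_height (fst c) 0 = edge_height (snd c) 0"
    using s edge_height_0[of "fst c" x] edge_height_0[of "snd c" x] by simp
  then have "fst c = snd c"
    using same_line_overlap[OF assms(1) c(1,2) s] x by blast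
  then show False using c(3) by blast
qed

lemma finite_line_edges: "finite P \<Longrightarrow> finite (line_edges P S)"
  by (rule finite_subset[of _ "P \<times> P"]) (auto simp: line_edges_def)

lemma finite_crossings: "finite P \<Longrightarrow> finite (crossings P S)"
  by (rule finite_subset[of _ "line_edges P S \<times> line_edges P S"])
    (auto simp: crossings_def finite_line_edges)

text \<open>Two lines meet in at most one point, and a line has at most one edge over a given abscissa.\<close>

lemma card_crossings_le:
  assumes "finite P" "inj_on fst P" "finite S"
  shows "card (crossings P S) \<le> (\<Sum>s\<in>S. card (line_class s ` P))\<^sup>2"
proof -
  define L where "L = (SIGMA s:S. line_class s ` P)"
  define l where "l e = (edge_slope e, edge_height e 0)" for e
  have lL: "l e \<in> L" if "e \<in> line_edges P S" for e
    using line_edgesD[OF that] by (simp add: L_def l_def edge_height_class)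
  have "inj_on (map_prod l l) (crossings P S)"
  proof (rule inj_onI)
    fix c d assume c: "c \<in> crossings P S" and d: "d \<in> crossings P S" and eq: "map_prod l l c = map_prod l l d"
    have eqs: "edge_slope (fst c) = edge_slope (fst d)" "edge_slope (snd c) = edge_slope (snd d)"
      "edge_height (fst c) 0 = edge_height (fst d) 0" "edge_height (snd c) 0 = edge_height (snd d) 0"
      using arg_cong[OF eq, of fst] arg_cong[OF eq, of snd] by (simp_all add: l_def)
    obtain x where cl: "fst c \<in> line_edges P S" "snd c \<in> line_edges P S"
      and x: "over x (fst c)" "over x (snd c)" "edge_height (fst c) x = edge_height (snd c) x"
      using c by (rule crossingsE)
    obtain y where dl: "fst d \<in> line_edges P S" "snd d \<in> line_edges P S"
      and y: "over y (fst d)" "over y (snd d)" "edge_height (fst d) y = edge_height (snd d) y"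
      using d by (rule crossingsE)
    have "(edge_slope (fst c) - edge_slope (snd c)) * (x - y) = 0"
      using x(3) y(3) eqs unfolding edge_height_0[of _ x] edge_height_0[of _ y] by (simp add: algebra_simps)
    then have "x = y" using crossings_slope[OF assms(2) c] by simp
    with x y eqs have "fst c = fst d" "snd c = snd d"
      using same_line_overlap[OF assms(2) cl(1) dl(1), of x] same_line_overlap[OF assms(2) cl(2) dl(2), of x]
      by simp_all
    then show "c = d" by (rule prod_eqI)
  qed
  moreover have "map_prod l l ` crossings P S \<subseteq> L \<times> L"
    using lL by (auto elim!: crossingsE)
  moreover have "finite L" using assms by (auto simp: L_def)
  ultimately have "card (crossings P S) \<le> card (L \<times> L)"
    by (intro card_inj_on_le) auto
  also have "card (L \<times> L) = (\<Sum>s\<in>S. card (line_class s ` P))\<^sup>2"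
    using assms by (simp add: L_def power2_eq_square)
  finally show ?thesis .
qed

text \<open>Edges of different slopes have only one common point, and here it is interior to both,
  so no end is shared. This gives a crossing the survival probability \<open>p ^ 4\<close> under
  sampling.\<close>

lemma crossings_four_ends:
  assumes "inj_on fst P" "c \<in> crossings P S"
  shows "card {fst (fst c), snd (fst c), fst (snd c), snd (snd c)} = 4"
proof -
  define e where "e = fst c" define f where "f = snd c"
  obtain x where ef: "e \<in> line_edges P S" "f \<in> line_edges P S"
    and x: "over x e" "over x f" "edge_height e x = edge_height f x"
    using assms(2) unfolding e_def f_def by (rule crossingsE)
  have sl: "edge_slope e \<noteq> edge_slope f" using crossings_slope[OF assms] by (simp add: e_def f_def)
  have meet: "y = x" if "edge_height e y = edge_height f y" for y
  proof -
    have "(edge_slope e - edge_slope f) * (y - x) = 0"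
      using that x(3) unfolding edge_height_0[of _ x] edge_height_0[of _ y] by (simp add: algebra_simps)
    then show ?thesis using sl by simp
  qed
  have r: "edge_height e (fst (snd e)) = snd (snd e)" "edge_height f (fst (snd f)) = snd (snd f)"
    using ef by (simp_all add: edge_height_right line_edgesD(3))
  have "fst e \<noteq> fst f" using meet[of "fst (fst e)"] x(1) by (auto simp: over_def)
  moreover have "snd e \<noteq> snd f" using meet[of "fst (snd e)"] r x(1) by (auto simp: over_def)
  moreover have "fst e \<noteq> snd e" "fst f \<noteq> snd f" "fst e \<noteq> snd f" "snd e \<noteq> fst f"
    using x(1,2) by (auto simp: over_def)
  ultimately show ?thesis by (simp add: e_def f_def)
qed

text \<open>On every line of slope \<open>s\<close> each point except the rightmost one starts an
  edge to its right neighbour, so at most one point per line is lost.\<close>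

lemma card_line_edges_slope_ge:
  assumes "finite P" "inj_on fst P" "s \<in> S"
  shows "card P \<le> card {e \<in> line_edges P S. edge_slope e = s} + card (line_class s ` P)"
proof -
  define Q where "Q = {p\<in>P. \<exists>q\<in>P. fst p < fst q \<and> line_class s p = line_class s q}"
  have "Q \<subseteq> fst ` {e \<in> line_edges P S. edge_slope e = s}"
  proof
    fix p assume p: "p \<in> Q"
    define W where "W = {q\<in>P. fst p < fst q \<and> line_class s p = line_class s q}"
    have "finite W" "W \<noteq> {}" using assms p by (auto simp: W_def Q_def)
    then obtain q where q: "q \<in> W" and qmin: "\<And>z. z \<in> W \<Longrightarrow> fst q \<le> fst z"
      by (metis (no_types, lifting) arg_min_if_finite(1) arg_min_least)
    have sl: "edge_slope (p, q) = s"
      using q by (auto simp: W_def edge_slope_def line_class_def field_simps)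
    have "snd z \<noteq> edge_height (p, q) (fst z)" if "z \<in> P" "over (fst z) (p, q)" for z
    proof
      assume "snd z = edge_height (p, q) (fst z)"
      then have "z \<in> W" using that sl by (auto simp: W_def over_def edge_height_def line_class_def algebra_simps)
      from qmin[OF this] that show False by (auto simp: over_def)
    qed
    then have "(p, q) \<in> {e \<in> line_edges P S. edge_slope e = s}"
      using sl p q assms(3) by (auto simp: line_edges_def Q_def W_def)
    then show "p \<in> fst ` {e \<in> line_edges P S. edge_slope e = s}" by force
  qed
  then have 1: "card Q \<le> card {e \<in> line_edges P S. edge_slope e = s}"
    using finite_line_edges[OF assms(1)] by (intro surj_card_le[of _ _ fst]) auto
  have 2: "card (P - Q) \<le> card (line_class s ` P)"
  proof (rule card_inj_on_le[of "line_class s"])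
    show "inj_on (line_class s) (P - Q)"
    proof (rule inj_onI)
      fix a b assume ab: "a \<in> P - Q" "b \<in> P - Q" "line_class s a = line_class s b"
      then have "\<not> fst a < fst b" "\<not> fst b < fst a" unfolding Q_def by auto
      then show "a = b" using ab assms(2) by (auto simp: inj_on_def)
    qed
  qed (use assms in auto)
  have "card P = card Q + card (P - Q)"
    using card_Int_Diff[OF assms(1), of Q] by (simp add: Q_def Int_absorb1 Int_def)
  with 1 2 show ?thesis by linarith
qed

text \<open>Dropping the first edge of every crossing inside \<open>R\<close> leaves a plane graph
  on \<open>R\<close>. Its edges join points consecutive in \<open>P\<close>, so none of them passes
  through a point of \<open>R\<close>.\<close>

lemma card_line_edges_induced_le:
  assumes "finite P" "inj_on fst P" "R \<subseteq> P"
  shows "card {e \<in> line_edges P S. {fst e, snd e} \<subseteq> R} \<le> 3 * card R +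
    card {c \<in> crossings P S. {fst (fst c), snd (fst c), fst (snd c), snd (snd c)} \<subseteq> R}"
proof -
  define C where "C = {c \<in> crossings P S. {fst (fst c), snd (fst c), fst (snd c), snd (snd c)} \<subseteq> R}"
  define N where "N = {e \<in> line_edges P S. {fst e, snd e} \<subseteq> R} - fst ` C"
  have fC: "finite C" using finite_crossings[OF assms(1)] by (simp add: C_def)
  interpret plane_graph R N
  proof
    show "finite R" using assms finite_subset by blast
    show "inj_on fst R" using assms inj_on_subset by blast
    fix e assume e: "e \<in> N"
    then show "fst e \<in> R \<and> snd e \<in> R \<and> fst (fst e) < fst (snd e)"
      by (simp add: N_def line_edgesD(3)[of e P S])
    show "snd z \<noteq> edge_height e (fst z)" if "z \<in> R" "over (fst z) e" for z
      using e that assms(3) line_edgesD(5)[of e P S z] by (auto simp: N_def)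
    show "edge_height e x \<noteq> edge_height f x" if "f \<in> N" "e \<noteq> f" "over x e" "over x f" for f x
    proof
      assume "edge_height e x = edge_height f x"
      then have "(e, f) \<in> C" using e that by (simp add: C_def N_def crossings_def) blast
      then have "e \<in> fst ` C" by (rule image_eqI[rotated]) simp
      then show False using e by (simp add: N_def)
    qed
  qed
  have "card {e \<in> line_edges P S. {fst e, snd e} \<subseteq> R} \<le> card N + card (fst ` C)"
    unfolding N_def using diff_card_le_card_Diff[OF finite_imageI[OF fC]] le_diff_conv by blast
  also have "\<dots> \<le> 3 * card R + card C"
    using card_edges_le card_image_le[OF fC] by (intro add_mono)
  finally show ?thesis by (simp add: C_def)
qed

text \<open>The preceding bound is averaged over a random \<open>R\<close>; points, edges and
  crossings survive with probabilities \<open>p\<close>, \<open>p ^ 2\<close> and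
  \<open>p ^ 4\<close>.\<close>

lemma line_edges_sampling:
  fixes p :: real
  assumes "finite P" "inj_on fst P" "0 \<le> p" "p \<le> 1"
  shows "real (card (line_edges P S)) * p\<^sup>2 \<le> 3 * (real (card P) * p) + real (card (crossings P S)) * p ^ 4"
proof -
  let ?w = "\<lambda>R. p ^ card R * (1 - p) ^ card (P - R)"
  let ?e = "\<lambda>R. real (card {e \<in> line_edges P S. {fst e, snd e} \<subseteq> R})"
  let ?c = "\<lambda>R. real (card {c \<in> crossings P S. {fst (fst c), snd (fst c), fst (snd c), snd (snd c)} \<subseteq> R})"
  have 1: "(\<Sum>R\<in>Pow P. ?w R * ?e R) = real (card (line_edges P S)) * p\<^sup>2"
    by (rule sum_sampling_card) (use assms finite_line_edges in \<open>auto simp: line_edges_def card_insert_if\<close>)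
  have 2: "(\<Sum>R\<in>Pow P. ?w R * ?c R) = real (card (crossings P S)) * p ^ 4"
  proof (rule sum_sampling_card)
    fix c assume c: "c \<in> crossings P S"
    then have "{fst (fst c), snd (fst c), fst (snd c), snd (snd c)} \<subseteq> P"
      by (elim crossingsE) (simp add: line_edgesD)
    with crossings_four_ends[OF assms(2) c]
    show "{fst (fst c), snd (fst c), fst (snd c), snd (snd c)} \<subseteq> P \<and>
        card {fst (fst c), snd (fst c), fst (snd c), snd (snd c)} = 4" by blast
  qed (use assms finite_crossings in auto)
  have 3: "(\<Sum>R\<in>Pow P. ?w R * real (card R)) = real (card P) * p"
  proof -
    have "(\<Sum>R\<in>Pow P. ?w R * real (card R)) = (\<Sum>R\<in>Pow P. ?w R * real (card {i\<in>P. {i} \<subseteq> R}))"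
      by (intro sum.cong refl arg_cong2[of _ _ _ _ "(*)"] arg_cong[of _ _ real] arg_cong[of _ _ card]) auto
    also have "\<dots> = real (card P) * p ^ 1"
      by (rule sum_sampling_card) (use assms in auto)
    finally show ?thesis by simp
  qed
  have "(\<Sum>R\<in>Pow P. ?w R * ?e R) \<le> (\<Sum>R\<in>Pow P. ?w R * (3 * real (card R) + ?c R))"
  proof (rule sum_mono)
    fix R assume "R \<in> Pow P"
    then have "?e R \<le> 3 * real (card R) + ?c R"
      using of_nat_mono[OF card_line_edges_induced_le[OF assms(1,2), of R S], where 'a = real]
      by (simp only: Pow_iff of_nat_add of_nat_mult of_nat_numeral)
    then show "?w R * ?e R \<le> ?w R * (3 * real (card R) + ?c R)"
      using assms by (intro mult_left_mono) auto
  qed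
  also have "\<dots> = 3 * (\<Sum>R\<in>Pow P. ?w R * real (card R)) + (\<Sum>R\<in>Pow P. ?w R * ?c R)"
    by (simp add: distrib_left sum.distrib sum_distrib_left mult.left_commute)
  finally show ?thesis using 1 2 3 by simp
qed

lemma few_lines_few_slopes:
  fixes t :: real
  assumes "finite P" "inj_on fst P" "finite S" "card S \<ge> 12" "P \<noteq> {}"
    and t: "\<And>s. s \<in> S \<Longrightarrow> real (card (line_class s ` P)) \<le> t" and tP: "t \<le> real (card P) / 2"
  shows "real (card S) * real (card P) \<le> 576 * t\<^sup>2"
proof -
  define m where "m = real (card P)"
  define r where "r = real (card S)"
  define e where "e = real (card (line_edges P S))"
  have m: "m > 0" using assms by (simp add: m_def card_gt_0_iff)
  have r: "r \<ge> 12" using assms by (simp add: r_def)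
  have e: "e \<ge> r * m / 2"
  proof -
    have "edge_slope ` line_edges P S \<subseteq> S" by (auto simp: line_edges_def)
    then have "card (line_edges P S) = (\<Sum>s\<in>S. card {e \<in> line_edges P S. edge_slope e = s})"
      using sum.group[OF finite_line_edges[OF assms(1)] assms(3), of edge_slope S "\<lambda>_. 1::nat"] by simp
    then have "e = (\<Sum>s\<in>S. real (card {e \<in> line_edges P S. edge_slope e = s}))"
      by (simp add: e_def)
    also have "\<dots> \<ge> (\<Sum>s\<in>S. m / 2)"
    proof (rule sum_mono)
      fix s assume s: "s \<in> S"
      show "m / 2 \<le> real (card {e \<in> line_edges P S. edge_slope e = s})"
        using card_line_edges_slope_ge[OF assms(1,2) s] t[OF s] tP unfolding m_def by linarith
    qed
    finally show ?thesis by (simp add: r_def)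
  qed
  \<comment> \<open>Twelve slopes with \<open>m / 2\<close> edges each give \<open>6 * m\<close>
    edges, which keeps the sampling probability below at most 1.\<close>
  have e6: "e \<ge> 6 * m" "e > 0"
    using e m r mult_right_mono[of 12 r m] by linarith+
  have c: "real (card (crossings P S)) \<le> (r * t)\<^sup>2"
  proof -
    have "real (\<Sum>s\<in>S. card (line_class s ` P)) \<le> r * t"
      using sum_mono[of S "\<lambda>s. real (card (line_class s ` P))" "\<lambda>_. t"] t by (simp add: r_def)
    moreover have "real (card (crossings P S)) \<le> (real (\<Sum>s\<in>S. card (line_class s ` P)))\<^sup>2"
      using of_nat_mono[OF card_crossings_le[OF assms(1-3)], where 'a = real] by simp
    ultimately show ?thesis
      using power_mono[of "real (\<Sum>s\<in>S. card (line_class s ` P))" "r * t" 2] by linarith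
  qed
  \<comment> \<open>A sampling probability at which the quadratic term in the edges is twice the linear one.\<close>
  define p where "p = 6 * m / e"
  have p: "0 < p" "p \<le> 1" "p * e = 6 * m" using e6 m by (auto simp: p_def)
  have "e * p\<^sup>2 \<le> 3 * (m * p) + (r * t)\<^sup>2 * p ^ 4"
    using line_edges_sampling[OF assms(1,2), of p S] p mult_right_mono[OF c, of "p ^ 4"]
    unfolding m_def e_def by (smt (verit) zero_le_power)
  also have "e * p\<^sup>2 = 6 * m * p" using p by (simp add: power2_eq_square mult.commute)
  finally have "3 * m * p \<le> (r * t)\<^sup>2 * p ^ 3 * p"
    by (simp add: power4_eq_xxxx power3_eq_cube algebra_simps)
  then have "3 * m \<le> (r * t)\<^sup>2 * p ^ 3" using p by simp
  \<comment> \<open>Multiplying by \<open>e ^ 3\<close> eliminates \<open>p\<close>, since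
    \<open>p * e = 6 * m\<close>. Then 72 is 6^3 / 3, and 576 is 8 * 72 with the 8 coming from
    \<open>(r * m / 2) ^ 3\<close>.\<close>
  then have "3 * m * e ^ 3 \<le> (r * t)\<^sup>2 * (p * e) ^ 3"
    using e6 by (simp add: power_mult_distrib mult.assoc[symmetric])
  then have "m * e ^ 3 \<le> m * (72 * (r * t)\<^sup>2 * m\<^sup>2)"
    unfolding p by (simp add: power_mult_distrib power3_eq_cube power2_eq_square algebra_simps)
  then have "e ^ 3 \<le> 72 * (r * t)\<^sup>2 * m\<^sup>2" using m by simp
  moreover have "(r * m / 2) ^ 3 \<le> e ^ 3" using e m r by (intro power_mono) auto
  ultimately have "(r * m / 2) ^ 3 \<le> 72 * (r * t)\<^sup>2 * m\<^sup>2" by linarith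
  then have "(r\<^sup>2 * m\<^sup>2) * (r * m) \<le> (r\<^sup>2 * m\<^sup>2) * (576 * t\<^sup>2)"
    by (simp add: power_mult_distrib power3_eq_cube power2_eq_square algebra_simps)
  moreover have "r\<^sup>2 * m\<^sup>2 > 0" using r m by simp
  ultimately have "r * m \<le> 576 * t\<^sup>2" by (rule mult_left_le_imp_le)
  then show ?thesis by (simp only: m_def r_def)
qed

subsection \<open>Pins with few dot products\<close>

abbreviation dots :: "real^2 \<Rightarrow> (real^2) set \<Rightarrow> real set" where
  "dots x A \<equiv> (\<lambda>y. x \<bullet> y) ` A"

text \<open>Two different points get the same sheared abscissa for at most one
  \<open>\<epsilon>\<close>, so finitely many values have to be avoided. Pairs with equal second
  coordinates add only the value 0, from division by zero, to the avoided set.\<close>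

lemma exists_generic_shear:
  fixes G :: "(real^2) set"
  assumes "finite G"
  obtains \<epsilon> where "inj_on (\<lambda>y. y $ 1 + \<epsilon> * y $ 2) G"
proof -
  have "finite ((\<lambda>(y, z). - (y $ 1 - z $ 1) / (y $ 2 - z $ 2)) ` (G \<times> G))" using assms by simp
  then obtain \<epsilon> where \<epsilon>: "\<epsilon> \<notin> (\<lambda>(y, z). - (y $ 1 - z $ 1) / (y $ 2 - z $ 2)) ` (G \<times> G)"
    using ex_new_if_finite[OF infinite_UNIV_char_0] by blast
  have "inj_on (\<lambda>y. y $ 1 + \<epsilon> * y $ 2) G"
  proof (rule inj_onI)
    fix y z assume yz: "y \<in> G" "z \<in> G" "y $ 1 + \<epsilon> * y $ 2 = z $ 1 + \<epsilon> * z $ 2"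
    have "\<epsilon> \<noteq> - (y $ 1 - z $ 1) / (y $ 2 - z $ 2)" using \<epsilon> yz by force
    moreover have "\<epsilon> = - (y $ 1 - z $ 1) / (y $ 2 - z $ 2)" if "y $ 2 \<noteq> z $ 2"
      using yz(3) that by (simp add: field_simps)
    ultimately have "y $ 2 = z $ 2" by blast
    then show "y = z" using yz(3) by (simp add: vec_eq_iff forall_2)
  qed
  then show ?thesis by (rule that)
qed

text \<open>
  A pin at \<open>x\<close> sorts \<open>G\<close> into parallel lines orthogonal to \<open>x\<close>, so it is bad or not according
  to its direction only; the slopes below are those of these lines after a generic shear.
\<close>

lemma card_bad_pins_le:
  fixes t M :: real and G B :: "(real^2) set"
  assumes "finite G" "G \<noteq> {}" "finite B"
    and bad: "\<And>x. x \<in> B \<Longrightarrow> real (card (dots x G)) \<le> t"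
    and t: "t \<le> real (card G) / 2"
    and M: "\<And>d. d \<noteq> 0 \<Longrightarrow> real (card (B \<inter> span {d})) \<le> M"
  shows "real (card B) \<le> 1 + M * max 12 (576 * t\<^sup>2 / real (card G))"
proof -
  have m: "real (card G) > 0" using assms by (simp add: card_gt_0_iff)
  obtain \<epsilon> where inj: "inj_on (\<lambda>y. y $ 1 + \<epsilon> * y $ 2) G"
    using exists_generic_shear[OF assms(1)] .
  define f where "f y = (y $ 1 + \<epsilon> * y $ 2, y $ 2)" for y :: "real^2"
  define P where "P = f ` G"
  define h where "h d = d $ 2 - \<epsilon> * d $ 1" for d :: "real^2"
  define \<sigma> where "\<sigma> d = - d $ 1 / h d" for d :: "real^2"
  \<comment> \<open>The zero vector has no direction; it accounts for the summand 1 in the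
    bound.\<close>
  define B0 where "B0 = B - {0}"
  define S where "S = \<sigma> ` B0"
  have "inj_on f G" using inj by (auto simp: inj_on_def f_def)
  then have cP: "card P = card G" by (simp add: P_def card_image)
  have fP: "finite P" "P \<noteq> {}" "finite S" "finite B0"
    using assms by (auto simp: P_def S_def B0_def)
  have iP: "inj_on fst P" using inj by (auto simp: inj_on_def P_def f_def)
  have dot: "d \<bullet> y = d $ 1 * (y $ 1 + \<epsilon> * y $ 2) + h d * y $ 2" for d y :: "real^2"
    by (simp add: inner_vec_def sum_2 h_def algebra_simps)
  have M0: "M \<ge> 0" using M[of "axis 1 1"] by (simp add: axis_eq_0_iff)
  \<comment> \<open>Lines that are vertical after the shear contain one point of \<open>G\<close>
    each, so such a pin separates all of \<open>G\<close> and is not bad.\<close>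
  have h0: "h d \<noteq> 0" if d: "d \<in> B0" for d
  proof
    assume z: "h d = 0"
    then have d1: "d $ 1 \<noteq> 0" using d by (auto simp: B0_def h_def vec_eq_iff forall_2)
    have "inj_on (\<lambda>y. d \<bullet> y) G"
      using inj d1 unfolding dot z by (auto simp: inj_on_def)
    then have "card (dots d G) = card G" by (rule card_image)
    then show False using bad[of d] t m d by (simp add: B0_def)
  qed
  have lines: "real (card (line_class s ` P)) \<le> t" if "s \<in> S" for s
  proof -
    obtain d where d: "d \<in> B0" "s = \<sigma> d" using \<open>s \<in> S\<close> by (auto simp: S_def)
    have "line_class s (f y) = (d \<bullet> y) / h d" for y
      using h0[OF d(1)] unfolding dot by (simp add: line_class_def f_def d(2) \<sigma>_def field_simps)
    then have "line_class s ` P = (\<lambda>r. r / h d) ` dots d G"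
      by (simp add: P_def image_image)
    then have "card (line_class s ` P) \<le> card (dots d G)"
      using assms(1) by (simp add: card_image_le)
    then show ?thesis using bad[of d] d by (simp add: B0_def)
  qed
  have fibre: "real (card {d \<in> B0. \<sigma> d = s}) \<le> M" if "s \<in> S" for s
  proof -
    obtain d where d: "d \<in> B0" "s = \<sigma> d" using \<open>s \<in> S\<close> by (auto simp: S_def)
    have "e \<in> span {d}" if "e \<in> B0" "\<sigma> e = s" for e
    proof -
      have "d $ 1 * h e = e $ 1 * h d"
        using that(2) d(2) h0[OF d(1)] h0[OF that(1)] by (simp add: \<sigma>_def field_simps)
      then have eq: "d $ 1 * e $ 2 = e $ 1 * d $ 2" by (simp add: h_def algebra_simps)
      have "\<exists>k. e = k *\<^sub>R d"
      proof (cases "d $ 1 = 0")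
        case True
        then have "d $ 2 \<noteq> 0" using d by (auto simp: B0_def vec_eq_iff forall_2)
        then have "e = (e $ 2 / d $ 2) *\<^sub>R d" using eq True by (simp add: vec_eq_iff forall_2)
        then show ?thesis ..
      next
        case False
        then have "e = (e $ 1 / d $ 1) *\<^sub>R d" using eq by (simp add: vec_eq_iff forall_2 field_simps)
        then show ?thesis ..
      qed
      then show ?thesis by (auto simp: span_singleton)
    qed
    then have "card {d \<in> B0. \<sigma> d = s} \<le> card (B \<inter> span {d})"
      using assms(3) by (intro card_mono) (auto simp: B0_def)
    then show ?thesis using M[of d] d by (simp add: B0_def)
  qed
  have "card B0 = (\<Sum>s\<in>S. card {d \<in> B0. \<sigma> d = s})"
    using sum.group[of B0 S \<sigma> "\<lambda>_. 1::nat"] fP by (simp add: S_def)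
  then have "real (card B0) \<le> (\<Sum>s\<in>S. M)"
    using fibre by (simp only: of_nat_sum) (rule sum_mono)
  then have B0: "real (card B0) \<le> M * real (card S)" by (simp add: mult.commute)
  have "real (card S) \<le> max 12 (576 * t\<^sup>2 / real (card G))"
  proof (cases "card S \<ge> 12")
    case True
    then have "real (card S) * real (card G) \<le> 576 * t\<^sup>2"
      using few_lines_few_slopes[OF fP(1) iP fP(3) _ fP(2) lines] t cP by simp
    then show ?thesis using m by (simp add: field_simps le_max_iff_disj)
  qed auto
  then have "M * real (card S) \<le> M * max 12 (576 * t\<^sup>2 / real (card G))"
    using M0 by (rule mult_left_mono)
  moreover have "card B \<le> card B0 + 1"
    unfolding B0_def using assms(3) by (simp add: card_Diff_singleton_if) arith
  ultimately show ?thesis using B0 by linarith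
qed

text \<open>A nonzero pin has different dot products with different points of its own line through
  the origin, so a single nonzero bad pin bounds the whole count. The case where 0 is the only bad
  pin uses \<open>t \<ge> 1\<close>. For pins taken from \<open>F\<close> this stands in for the
  assumption made on \<open>E\<close>.\<close>

lemma card_bad_on_line_le:
  fixes t :: real and A :: "(real^2) set"
  assumes "finite A" "t \<ge> 1"
  shows "real (card ({x \<in> A. real (card (dots x A)) < t} \<inter> span {d})) \<le> t"
proof (cases "{x \<in> A. real (card (dots x A)) < t} \<inter> span {d} \<subseteq> {0}")
  case True
  from card_mono[OF _ True] show ?thesis using assms(2) by simp
next
  case False
  then obtain u where u: "u \<in> A" "real (card (dots u A)) < t" "u \<in> span {d}" "u \<noteq> 0" by blast
  let ?B = "{x \<in> A. real (card (dots x A)) < t} \<inter> span {d}"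
  have "inj_on (\<lambda>y. u \<bullet> y) (span {d})"
    using u by (auto simp: inj_on_def span_singleton)
  then have "card ?B = card ((\<lambda>y. u \<bullet> y) ` ?B)"
    by (metis (no_types, lifting) card_image inf_le2 inj_on_subset)
  also have "\<dots> \<le> card (dots u A)" using assms(1) by (intro card_mono) auto
  finally show ?thesis using u(2) by linarith
qed

text \<open>In the application \<open>q\<close> is the cube root of \<open>n\<close> and
  \<open>K\<close> is \<open>k + 1\<close>. The crossing term and the lower-order terms each get
  half of the final bound.\<close>

lemma card_bad_pins_le_fraction:
  fixes q K :: real and G B :: "(real^2) set"
  assumes "finite G" "finite B" and K: "K \<ge> 1" "q \<ge> 100 * K"
    and G: "real (card G) \<ge> q ^ 3 / 2"
    and bad: "\<And>x. x \<in> B \<Longrightarrow> real (card (dots x G)) \<le> q\<^sup>2 / (68 * K)"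
    and M: "\<And>d. d \<noteq> 0 \<Longrightarrow> real (card (B \<inter> span {d})) \<le> q\<^sup>2"
  shows "real (card B) \<le> q ^ 3 / (2 * K)"
proof -
  have q: "q \<ge> 100" "q > 0" using K by auto
  have m: "real (card G) > 0" using G zero_less_power[OF q(2), of 3] by linarith
  then have "G \<noteq> {}" by auto
  have q23: "q\<^sup>2 \<le> q ^ 3" using q by (intro power_increasing) auto
  define t where "t = q\<^sup>2 / (68 * K)"
  have "t \<le> q\<^sup>2 / 4" unfolding t_def using K q by (intro divide_left_mono) auto
  then have "t \<le> real (card G) / 2" using q23 G by linarith
  from card_bad_pins_le[OF assms(1) \<open>G \<noteq> {}\<close> assms(2) bad[folded t_def] this M]
  have "real (card B) \<le> 1 + q\<^sup>2 * max 12 (576 * t\<^sup>2 / real (card G))" by blast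
  also have "max 12 (576 * t\<^sup>2 / real (card G)) \<le> 12 + 576 * t\<^sup>2 / real (card G)"
    using m by simp
  also have "576 * t\<^sup>2 / real (card G) \<le> 576 * t\<^sup>2 / (q ^ 3 / 2)"
    using G m q by (intro divide_left_mono) auto
  also have "\<dots> = 1152 * q / (68 * K)\<^sup>2"
    using q by (simp add: t_def power_divide power2_eq_square power3_eq_cube)
  \<comment> \<open>This fixes the constant 68, the least integer whose square is at least 4 * 1152
    = 4608.\<close>
  also have "\<dots> \<le> q / (4 * K)"
  proof -
    have "1152 * q * (4 * K) \<le> q * (68 * K)\<^sup>2"
      using K q by (simp add: power2_eq_square)
    then show ?thesis using K by (simp add: field_simps)
  qed
  finally have "real (card B) \<le> 1 + q\<^sup>2 * (12 + q / (4 * K))"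
    by (simp add: mult_left_mono)
  also have "\<dots> = 1 + 12 * q\<^sup>2 + q ^ 3 / (4 * K)"
    by (simp add: power2_eq_square power3_eq_cube algebra_simps)
  also have "1 + 12 * q\<^sup>2 \<le> 13 * q\<^sup>2" using one_le_power[of q 2] q by simp
  \<comment> \<open>After division by the square of \<open>q\<close> this reads
    \<open>52 * K \<le> q\<close>.\<close>
  also have "13 * q\<^sup>2 \<le> q ^ 3 / (4 * K)"
  proof -
    have "q\<^sup>2 * (52 * K) \<le> q\<^sup>2 * q" using K by (intro mult_left_mono) auto
    then show ?thesis using K by (simp add: field_simps power2_eq_square power3_eq_cube)
  qed
  finally show ?thesis using K by (simp add: field_simps)
qed

subsection \<open>Weighted copies of trees\<close>

text \<open>Growing a tree from the pinned vertex by attaching leaves provides the induction along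
  which weights are counted.\<close>

inductive rooted_tree :: "'a \<Rightarrow> 'a set \<Rightarrow> 'a set set \<Rightarrow> bool" for v where
  root: "rooted_tree v {v} {}"
| leaf: "rooted_tree v V Es \<Longrightarrow> u \<in> V \<Longrightarrow> l \<notin> V \<Longrightarrow> rooted_tree v (insert l V) (insert {u, l} Es)"

lemma rooted_tree_edges:
  assumes "rooted_tree v V Es"
  shows "finite Es \<and> finite V \<and> v \<in> V \<and> card V = card Es + 1 \<and> (\<forall>e\<in>Es. \<exists>a\<in>V. \<exists>b\<in>V. e = {a, b})"
  using assms
proof induction
  case (leaf V Es u l)
  then have "{u, l} \<notin> Es" by (metis doubleton_eq_iff)
  with leaf show ?case by auto
qed auto

section \<open>Longest paths, leaves, and the growth of a tree from its root\<close>

definition simple_path :: "'a set \<Rightarrow> 'a set set \<Rightarrow> 'a list \<Rightarrow> bool" where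
  "simple_path V Es p \<longleftrightarrow> p \<noteq> [] \<and> distinct p \<and> set p \<subseteq> V \<and>
     (\<forall>i. Suc i < length p \<longrightarrow> {p ! i, p ! Suc i} \<in> Es)"

lemma simple_path_snoc:
  assumes "simple_path V Es p" "y \<in> V" "y \<notin> set p" "{last p, y} \<in> Es"
  shows "simple_path V Es (p @ [y])"
proof -
  have "{(p @ [y]) ! i, (p @ [y]) ! Suc i} \<in> Es" if "Suc i < length (p @ [y])" for i
  proof (cases "Suc i < length p")
    case True
    then show ?thesis using assms(1) by (simp add: simple_path_def nth_append)
  next
    case False
    then have "Suc i = length p" using that by simp
    then have "i = length p - 1" "Suc i = length p" by auto
    then show ?thesis using assms(1,4) by (simp add: simple_path_def nth_append last_conv_nth)
  qed
  then show ?thesis using assms by (auto simp: simple_path_def)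
qed

text \<open>The chord closes the tail of the path, to which \<open>i + 2 < length p\<close> gives at
  least three vertices.\<close>

lemma simple_path_chord_cycle:
  assumes p: "simple_path V Es p" and i: "i + 2 < length p" and e: "{p ! i, last p} \<in> Es"
  shows "graph_cycle Es (drop i p)"
  unfolding graph_cycle_def
proof (intro conjI allI impI)
  show "3 \<le> length (drop i p)" "distinct (drop i p)"
    using assms by (auto simp: simple_path_def)
  fix j assume j: "j < length (drop i p)"
  show "{drop i p ! j, drop i p ! (Suc j mod length (drop i p))} \<in> Es"
  proof (cases "Suc j < length (drop i p)")
    case True
    then show ?thesis using p by (simp add: simple_path_def)
  next
    case False
    then have "Suc j = length (drop i p)" using j by simp
    then have "Suc j mod length (drop i p) = 0" "i + j = length p - 1" by auto
    then show ?thesis using e i p j by (simp add: simple_path_def last_conv_nth insert_commute)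
  qed
qed

text \<open>The leaf is the last vertex of a longest path from \<open>v\<close>. Its neighbours lie
  on the path by maximality, and all but the preceding vertex are excluded because they would close
  a cycle.\<close>

lemma exists_leaf:
  assumes G: "simple_graph V Es" and v: "v \<in> V" and V: "V \<noteq> {v}"
    and conn: "\<forall>b\<in>V. (v, b) \<in> {(s, t). {s, t} \<in> Es}\<^sup>*" and acyc: "\<nexists>c. graph_cycle Es c"
  shows "\<exists>l\<in>V. \<exists>u\<in>V. l \<noteq> v \<and> u \<noteq> l \<and> {u, l} \<in> Es \<and> (\<forall>y. {y, l} \<in> Es \<longrightarrow> y = u)"
proof -
  have fV: "finite V" using G by (simp add: simple_graph_def)
  have edge: "a \<in> V \<and> b \<in> V \<and> a \<noteq> b" if "{a, b} \<in> Es" for a b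
  proof -
    obtain c d where "c \<in> V" "d \<in> V" "c \<noteq> d" "{a, b} = {c, d}"
      using G \<open>{a, b} \<in> Es\<close> unfolding simple_graph_def by blast
    then show ?thesis by (auto simp: doubleton_eq_iff)
  qed
  define paths where "paths p \<longleftrightarrow> simple_path V Es p \<and> hd p = v" for p
  have "paths [v]" using v by (simp add: paths_def simple_path_def)
  moreover have "length p \<le> card V" if "paths p" for p
    using that card_mono[OF fV, of "set p"] distinct_card[of p] by (simp add: paths_def simple_path_def)
  ultimately have "\<exists>p. paths p \<and> (\<forall>r. paths r \<longrightarrow> length r \<le> length p)"
    by (intro ex_has_greatest_nat[of paths "[v]" length "Suc (card V)"])
      (auto simp: less_Suc_eq_le)
  then obtain p where p: "paths p" and pmax: "\<And>r. paths r \<Longrightarrow> length r \<le> length p"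
    by blast
  have sp: "simple_path V Es p" and hp: "hd p = v" using p by (auto simp: paths_def)
  then have ne: "p \<noteq> []" by (simp add: simple_path_def)
  define l where "l = last p"
  have only_back: "y \<in> set p" if "{y, l} \<in> Es" for y
  proof (rule ccontr)
    assume "y \<notin> set p"
    with that have "paths (p @ [y])"
      using simple_path_snoc[OF sp, of y] edge hp ne by (auto simp: paths_def l_def insert_commute)
    from pmax[OF this] show False by simp
  qed
  have len: "length p \<ge> 2"
  proof (rule ccontr)
    assume "\<not> ?thesis"
    then have pv: "p = [v]" using ne hp by (cases p) (auto simp: not_le Suc_less_eq2)
    obtain b where b: "b \<in> V" "b \<noteq> v" using V v by blast
    then have "(v, b) \<in> {(s, t). {s, t} \<in> Es}\<^sup>*" using conn by blast
    then obtain y where "{v, y} \<in> Es" using b by (auto elim: converse_rtranclE)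
    then show False using only_back[of y] edge[of v y] pv by (simp add: l_def insert_commute)
  qed
  define u where "u = p ! (length p - 2)"
  have lnth: "l = p ! (length p - 1)" using ne by (simp add: l_def last_conv_nth)
  have "Suc (length p - 2) = length p - 1" "Suc (length p - 2) < length p" using len by auto
  then have ul: "{u, l} \<in> Es"
    using sp unfolding u_def lnth simple_path_def by metis
  have "y = u" if y: "{y, l} \<in> Es" for y
  proof -
    obtain i where i: "i < length p" "y = p ! i" using only_back[OF y] by (metis in_set_conv_nth)
    have "i \<noteq> length p - 1" using edge[OF y] i lnth by auto
    moreover have "\<not> i + 2 < length p"
      using simple_path_chord_cycle[OF sp, of i] y i acyc by (auto simp: l_def)
    ultimately have "i = length p - 2" using i by linarith
    then show ?thesis using i by (simp add: u_def)
  qed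
  moreover have "l \<noteq> v"
  proof -
    have "p ! (length p - 1) \<noteq> p ! 0" using sp len by (subst nth_eq_iff_index_eq) (auto simp: simple_path_def)
    then show ?thesis using hp ne by (simp add: lnth hd_conv_nth)
  qed
  ultimately show ?thesis using ul edge[OF ul] by blast
qed

text \<open>A leaf other than the root is removed. Connectedness is phrased as reachability from the
  root, since this form passes easily to the smaller graph.\<close>

lemma rooted_tree_if_reachable:
  assumes "simple_graph V Es" "v \<in> V" "\<forall>b\<in>V. (v, b) \<in> {(s, t). {s, t} \<in> Es}\<^sup>*" "\<nexists>c. graph_cycle Es c"
  shows "rooted_tree v V Es"
  using assms
proof (induction "card V" arbitrary: V Es rule: less_induct)
  case less
  have fV: "finite V" and edge: "\<And>e. e \<in> Es \<Longrightarrow> \<exists>a\<in>V. \<exists>b\<in>V. a \<noteq> b \<and> e = {a, b}"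
    using less.prems(1) by (auto simp: simple_graph_def)
  show ?case
  proof (cases "V = {v}")
    case True
    then have "Es = {}" using edge by blast
    then show ?thesis using True rooted_tree.root by simp
  next
    case False
    obtain l u where l: "l \<in> V" "u \<in> V" "l \<noteq> v" "u \<noteq> l" "{u, l} \<in> Es"
      and only: "\<And>y. {y, l} \<in> Es \<Longrightarrow> y = u"
      using exists_leaf[OF less.prems(1,2) False less.prems(3,4)] by blast
    define V' where "V' = V - {l}"
    define Es' where "Es' = Es - {{u, l}}"
    have edge': "e \<in> Es'" if "e \<in> Es" "l \<notin> e" for e
      using that by (auto simp: Es'_def)
    have off: "l \<notin> e" if "e \<in> Es'" for e
    proof
      assume "l \<in> e"
      have "e \<in> Es" "e \<noteq> {u, l}" using that by (auto simp: Es'_def)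
      then obtain y where "e = {y, l}" using edge[of e] \<open>l \<in> e\<close> by blast
      then show False using only \<open>e \<in> Es\<close> \<open>e \<noteq> {u, l}\<close> by blast
    qed
    have "rooted_tree v V' Es'"
    proof (rule less.hyps)
      show "card V' < card V" unfolding V'_def using l fV by (intro psubset_card_mono) auto
      show "v \<in> V'" using less.prems(2) l by (simp add: V'_def)
      show "\<nexists>c. graph_cycle Es' c" using less.prems(4) by (auto simp: graph_cycle_def Es'_def)
      show "simple_graph V' Es'" unfolding simple_graph_def
      proof (intro conjI ballI)
        show "finite V'" using fV by (simp add: V'_def)
        fix e assume e: "e \<in> Es'"
        then have "e \<in> Es" by (simp add: Es'_def)
        from edge[OF this] off[OF e] show "\<exists>a\<in>V'. \<exists>b\<in>V'. a \<noteq> b \<and> e = {a, b}"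
          unfolding V'_def by blast
      qed
      \<comment> \<open>A walk is rerouted by waiting at \<open>u\<close> whenever it visits the
        leaf \<open>l\<close>.\<close>
      have reach: "(v, if b = l then u else b) \<in> {(s, t). {s, t} \<in> Es'}\<^sup>*"
        if "(v, b) \<in> {(s, t). {s, t} \<in> Es}\<^sup>*" for b
        using that
      proof induction
        case base
        then show ?case using l by simp
      next
        case (step y z)
        then have yz: "{y, z} \<in> Es" by simp
        show ?case
        proof (cases "y = l \<or> z = l")
          case True
          then have "(if z = l then u else z) = (if y = l then u else y)"
            using yz only[of y] only[of z] l by (auto simp: insert_commute)
          then show ?thesis using step.IH by simp
        next
          case False
          then have "{y, z} \<in> Es'" using edge' yz by auto
          then show ?thesis using step.IH False by (auto intro: rtrancl_into_rtrancl)
        qed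
      qed
      show "\<forall>b\<in>V'. (v, b) \<in> {(s, t). {s, t} \<in> Es'}\<^sup>*"
      proof
        fix b assume "b \<in> V'"
        then show "(v, b) \<in> {(s, t). {s, t} \<in> Es'}\<^sup>*"
          using reach[of b] less.prems(3) by (simp add: V'_def)
      qed
    qed
    from rooted_tree.leaf[OF this, of u l] l show ?thesis
      by (simp add: V'_def Es'_def insert_absorb)
  qed
qed

lemma rooted_tree_if_is_tree: "is_tree V Es \<Longrightarrow> v \<in> V \<Longrightarrow> rooted_tree v V Es"
  by (rule rooted_tree_if_reachable) (auto simp: is_tree_def graph_connected_def)

text \<open>The choice of \<open>a\<close> and \<open>b\<close> does not matter because the dot
  product is symmetric.\<close>

definition edge_weight :: "('a \<Rightarrow> real^2) \<Rightarrow> 'a set \<Rightarrow> real" where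
  "edge_weight \<phi> e = (THE r. \<exists>a b. e = {a, b} \<and> r = \<phi> a \<bullet> \<phi> b)"

lemma edge_weight_doubleton [simp]: "edge_weight \<phi> {a, b} = \<phi> a \<bullet> \<phi> b"
  unfolding edge_weight_def by (rule the_equality) (auto simp: doubleton_eq_iff inner_commute)

section \<open>Weight tuples as functions on the edge set\<close>

definition copies :: "'a set \<Rightarrow> 'a \<Rightarrow> real^2 \<Rightarrow> (real^2) set \<Rightarrow> ('a \<Rightarrow> real^2) set" where
  "copies V v x F = {\<phi>. inj_on \<phi> V \<and> \<phi> v = x \<and> (\<forall>u\<in>V - {v}. \<phi> u \<in> F)}"

text \<open>Indexing weights by edges instead of list positions lets a leaf be added without regard
  to the order of the edges. The restriction makes functions with equal weights equal.\<close>

definition weightings :: "'a set \<Rightarrow> 'a set set \<Rightarrow> 'a \<Rightarrow> real^2 \<Rightarrow> (real^2) set \<Rightarrow> ('a set \<Rightarrow> real) set" where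
  "weightings V Es v x F = (\<lambda>\<phi>. restrict (edge_weight \<phi>) Es) ` copies V v x F"

lemma finite_weightings:
  assumes "rooted_tree v V Es" "finite F"
  shows "finite (weightings V Es v x F)"
proof (rule finite_subset)
  let ?D = "(\<lambda>(a, b). a \<bullet> b) ` (insert x F \<times> insert x F)"
  show "weightings V Es v x F \<subseteq> PiE Es (\<lambda>_. ?D)"
  proof
    fix g assume "g \<in> weightings V Es v x F"
    then obtain \<phi> where \<phi>: "\<phi> \<in> copies V v x F" "g = restrict (edge_weight \<phi>) Es"
      by (auto simp: weightings_def)
    have "\<phi> a \<in> insert x F" if "a \<in> V" for a
      using \<phi>(1) that by (cases "a = v") (auto simp: copies_def)
    moreover have "\<exists>a\<in>V. \<exists>b\<in>V. e = {a, b}" if "e \<in> Es" for e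
      using rooted_tree_edges[OF assms(1)] that by blast
    ultimately show "g \<in> PiE Es (\<lambda>_. ?D)"
      unfolding \<phi>(2) restrict_PiE_iff
      by (smt (verit, best) SigmaI case_prod_conv edge_weight_doubleton image_eqI)
  qed
  show "finite (PiE Es (\<lambda>_. ?D))"
    using rooted_tree_edges[OF assms(1)] assms(2) by (intro finite_PiE) auto
qed

lemma pinned_weights_eq:
  assumes "rooted_tree v V (set es)"
  shows "pinned_weights V es v x F = (\<lambda>g. map g es) ` weightings V (set es) v x F"
proof -
  have doubleton: "\<exists>a b. es ! j = {a, b}" if "j < length es" for j
    using rooted_tree_edges[OF assms] nth_mem[OF that] by blast
  have "pinned_copy V es w v x F \<phi> \<longleftrightarrow> \<phi> \<in> copies V v x F \<and> w = map (edge_weight \<phi>) es"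
    if "length w = length es" for w \<phi>
  proof -
    have "(\<forall>a b. es ! j = {a, b} \<longrightarrow> \<phi> a \<bullet> \<phi> b = w ! j) \<longleftrightarrow> w ! j = edge_weight \<phi> (es ! j)"
      if "j < length es" for j
      using doubleton[OF that] by (metis edge_weight_doubleton)
    then show ?thesis
      using that by (auto simp: pinned_copy_def copies_def list_eq_iff_nth_eq)
  qed
  then have "pinned_weights V es v x F = (\<lambda>\<phi>. map (edge_weight \<phi>) es) ` copies V v x F"
    by (auto simp: pinned_weights_def)
  also have "\<dots> = (\<lambda>g. map g es) ` weightings V (set es) v x F"
    unfolding weightings_def image_image by (intro image_cong refl) simp
  finally show ?thesis .
qed

lemma card_pinned_weights:
  assumes "rooted_tree v V (set es)"
  shows "card (pinned_weights V es v x F) = card (weightings V (set es) v x F)"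
  unfolding pinned_weights_eq[OF assms]
proof (rule card_image, rule inj_onI)
  fix g h assume gh: "g \<in> weightings V (set es) v x F" "h \<in> weightings V (set es) v x F" "map g es = map h es"
  then have "g \<in> extensional (set es)" "h \<in> extensional (set es)"
    by (auto simp: weightings_def)
  with gh(3) show "g = h" by (intro extensionalityI) auto
qed

text \<open>One copy is fixed for every weighting of the smaller tree. The image of \<open>u\<close>
  is a rich pin for \<open>A\<close>, and keeping the new vertex off the used points costs at most
  \<open>card V\<close> dot products. Each remaining value extends the weighting
  differently.\<close>

lemma card_weightings_leaf:
  fixes K :: real
  assumes T: "rooted_tree v V Es" and u: "u \<in> V" and l: "l \<notin> V"
    and A: "A' \<subseteq> A" "finite A"
    and K: "\<And>y. y \<in> insert x A' \<Longrightarrow> K + real (card V) \<le> real (card (dots y A))"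
  shows "real (card (weightings V Es v x A')) * K \<le> real (card (weightings (insert l V) (insert {u, l} Es) v x A))"
proof -
  define W where "W = weightings V Es v x A'"
  note facts = rooted_tree_edges[OF T]
  have "\<forall>g\<in>W. \<exists>\<phi>. \<phi> \<in> copies V v x A' \<and> g = restrict (edge_weight \<phi>) Es"
    by (auto simp: W_def weightings_def)
  then obtain \<Phi> where \<Phi>: "\<And>g. g \<in> W \<Longrightarrow> \<Phi> g \<in> copies V v x A'"
    and g\<Phi>: "\<And>g. g \<in> W \<Longrightarrow> g = restrict (edge_weight (\<Phi> g)) Es" by metis
  define X where "X g = dots (\<Phi> g u) (A - \<Phi> g ` V)" for g
  have fW: "finite W"
    unfolding W_def using T finite_subset[OF A] by (rule finite_weightings)
  have new: "{u, l} \<notin> Es" using facts l by (metis doubleton_eq_iff)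
  have X: "K \<le> real (card (X g))" if "g \<in> W" for g
  proof -
    have "\<Phi> g u \<in> insert x A'"
      using \<Phi>[OF that] u by (cases "u = v") (auto simp: copies_def)
    then have "K + real (card V) \<le> real (card (dots (\<Phi> g u) A))" by (rule K)
    also have "card (dots (\<Phi> g u) A) \<le> card (X g \<union> dots (\<Phi> g u) (\<Phi> g ` V))"
      unfolding X_def using A facts by (intro card_mono) auto
    also have "\<dots> \<le> card (X g) + card (dots (\<Phi> g u) (\<Phi> g ` V))" by (rule card_Un_le)
    also have "card (dots (\<Phi> g u) (\<Phi> g ` V)) \<le> card V"
      unfolding image_image using facts by (intro card_image_le) blast
    finally show ?thesis by simp
  qed
  have "real (card W) * K = (\<Sum>g\<in>W. K)" by simp
  also have "\<dots> \<le> (\<Sum>g\<in>W. real (card (X g)))" by (rule sum_mono) (rule X)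
  also have "\<dots> = real (card (Sigma W X))"
    using fW A by (simp add: X_def)
  also have "card (Sigma W X) \<le> card (weightings (insert l V) (insert {u, l} Es) v x A)"
  proof (rule card_inj_on_le)
    show "finite (weightings (insert l V) (insert {u, l} Es) v x A)"
      using rooted_tree.leaf[OF T u l] A(2) by (rule finite_weightings)
    show "inj_on (\<lambda>(g, r). g({u, l} := r)) (Sigma W X)"
    proof (rule inj_onI, clarify)
      fix g r g' r' assume gr: "g \<in> W" "g' \<in> W" and eq: "g({u, l} := r) = g'({u, l} := r')"
      have "g \<in> extensional Es" "g' \<in> extensional Es" using gr by (auto simp: W_def weightings_def)
      \<comment> \<open>Both functions take the default value at the new edge, so the update there
        loses no information.\<close>
      then have "g {u, l} = g' {u, l}" using extensional_arb[OF _ new] by metis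
      then have "g e = g' e" for e
        using fun_cong[OF eq, of e] by (cases "e = {u, l}") simp_all
      then show "g = g' \<and> r = r'" using fun_cong[OF eq, of "{u, l}"] by (simp add: fun_eq_iff)
    qed
    show "(\<lambda>(g, r). g({u, l} := r)) ` Sigma W X \<subseteq> weightings (insert l V) (insert {u, l} Es) v x A"
    proof clarify
      fix g r assume g: "g \<in> W" and "r \<in> X g"
      define \<phi> where "\<phi> = \<Phi> g"
      have \<phi>: "\<phi> \<in> copies V v x A'" "g = restrict (edge_weight \<phi>) Es"
        unfolding \<phi>_def by (rule \<Phi>[OF g], rule g\<Phi>[OF g])
      obtain y where y: "y \<in> A" "y \<notin> \<phi> ` V" "r = \<phi> u \<bullet> y"
        using \<open>r \<in> X g\<close> by (auto simp: X_def \<phi>_def)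
      define \<psi> where "\<psi> = \<phi>(l := y)"
      have V: "\<psi> a = \<phi> a" if "a \<in> V" for a using that l by (auto simp: \<psi>_def)
      have "v \<in> V" using facts by blast
      then have "\<psi> \<in> copies (insert l V) v x A"
        using \<phi>(1) y l A(1) by (auto simp: copies_def \<psi>_def inj_on_def)
      moreover have "edge_weight \<psi> e = edge_weight \<phi> e" if "e \<in> Es" for e
        using facts that V by (metis edge_weight_doubleton)
      then have "g({u, l} := r) = restrict (edge_weight \<psi>) (insert {u, l} Es)"
        using V[OF u] y new unfolding \<phi>(2) by (auto simp: fun_eq_iff \<psi>_def)
      ultimately show "g({u, l} := r) \<in> weightings (insert l V) (insert {u, l} Es) v x A"
        unfolding weightings_def by blast
    qed
  qed
  finally show ?thesis by (simp add: W_def)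
qed

text \<open>
  The last leaf is placed in \<open>A i\<close> and the rest of the tree in \<open>A (Suc i)\<close>, so that its
  neighbour is a rich pin for \<open>A i\<close>.
\<close>

lemma card_weightings_ge:
  fixes K :: real and A :: "nat \<Rightarrow> (real^2) set"
  assumes "rooted_tree v V Es" "i + card Es \<le> k" "K \<ge> 0"
    and fin: "finite (A 0)" and dec: "decseq A"
    and rich: "\<And>i y. i < k \<Longrightarrow> y \<in> insert x (A (Suc i)) \<Longrightarrow> K + real k \<le> real (card (dots y (A i)))"
  shows "K ^ card Es \<le> real (card (weightings V Es v x (A i)))"
proof -
  have fA: "finite (A i)" for i
    using decseqD[OF dec, of 0 i] by (intro finite_subset[OF _ fin]) simp
  show ?thesis
    using assms(1,2)
  proof (induction arbitrary: i)
    case root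
    have "(\<lambda>_. x) \<in> copies {v} v x (A i)" by (simp add: copies_def)
    then have "weightings {v} {} v x (A i) \<noteq> {}" unfolding weightings_def by blast
    moreover have "finite (weightings {v} {} v x (A i))"
      using rooted_tree.root fA by (rule finite_weightings)
    ultimately have "card (weightings {v} {} v x (A i)) \<ge> 1" by (simp add: Suc_le_eq card_gt_0_iff)
    then show ?case by simp
  next
    case (leaf V Es u l)
    note facts = rooted_tree_edges[OF leaf.hyps(1)]
    have "{u, l} \<notin> Es" using facts leaf.hyps by (metis doubleton_eq_iff)
    then have c: "card (insert {u, l} Es) = Suc (card Es)" using facts by simp
    then have i: "Suc i + card Es \<le> k" using leaf.prems by simp
    have "K ^ Suc (card Es) \<le> real (card (weightings V Es v x (A (Suc i)))) * K"
      using mult_right_mono[OF leaf.IH[OF i] assms(3)] by (simp add: mult.commute)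
    also have "\<dots> \<le> real (card (weightings (insert l V) (insert {u, l} Es) v x (A i)))"
    proof (rule card_weightings_leaf[OF leaf.hyps])
      show "A (Suc i) \<subseteq> A i" "finite (A i)"
        using decseqD[OF dec, of i "Suc i"] fA by auto
      show "K + real (card V) \<le> real (card (dots y (A i)))" if "y \<in> insert x (A (Suc i))" for y
      proof -
        have "card V \<le> k" using facts i by linarith
        moreover have "K + real k \<le> real (card (dots y (A i)))"
          using i by (intro rich that) simp
        ultimately show ?thesis by linarith
      qed
    qed
    finally show ?case by (simp add: c)
  qed
qed

section \<open>Repeated passage to rich pins\<close>

theorem theorem2p5:
  fixes k :: nat
  assumes "k \<ge> 1"
  shows "\<exists>c::real. c > 0 \<and> (\<exists>err::nat \<Rightarrow> real. err \<in> o(\<lambda>n. real n) \<and>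
    (\<forall>\<^sub>F n in sequentially.
      \<forall>(V::nat set) (es::nat set list) v (E::(real^2) set) (F::(real^2) set).
        is_tree V (set es) \<and> distinct es \<and> length es = k \<and> v \<in> V \<and>
        finite E \<and> finite F \<and> card E = n \<and> card F = n \<and>
        (\<forall>d. d \<noteq> 0 \<longrightarrow> real (card (E \<inter> span {d})) \<le> real n powr (2 / 3)) \<longrightarrow>
        (\<exists>E'\<subseteq>E. real (card E') \<ge> real n / 2 ^ k - err n \<and>
          (\<forall>x\<in>E'. real (card (pinned_weights V es v x F)) \<ge> c * real n powr (2 * real k / 3)))))"
proof -
  \<comment> \<open>Every pass loses at most \<open>n / (2 * \<kappa>)\<close> points, so after at
    most \<open>k\<close> passes half of \<open>F\<close> is left.\<close>
  define \<kappa> where "\<kappa> = real k + 1"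
  have \<kappa>: "\<kappa> \<ge> 1" by (simp add: \<kappa>_def)
  \<comment> \<open>Chosen so that \<open>c * q ^ (2 * k)\<close> equals \<open>(t / 2) ^ k\<close>
    for the threshold \<open>t\<close> below.\<close>
  define c where "c = (1 / (136 * \<kappa>)) ^ k"
  \<comment> \<open>The set found has at least \<open>n / 2\<close> points, so the error term can be
    0.\<close>
  have main: "\<exists>E'\<subseteq>E. real (card E') \<ge> real n / 2 ^ k - 0 \<and>
      (\<forall>x\<in>E'. real (card (pinned_weights V es v x F)) \<ge> c * real n powr (2 * real k / 3))"
    if n: "n \<ge> (100 * (k + 1)) ^ 3"
      and tree: "is_tree V (set es)" "distinct es" "length es = k" "v \<in> V"
      and EF: "finite E" "finite F" "card E = n" "card F = n"
      and lines: "\<forall>d. d \<noteq> 0 \<longrightarrow> real (card (E \<inter> span {d})) \<le> real n powr (2 / 3)"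
    for n and V :: "nat set" and es :: "nat set list" and v and E F :: "(real^2) set"
  proof -
    define q where "q = real n powr (1 / 3)"
    have q0: "q \<ge> 0" by (simp add: q_def)
    have "0 < (100 * (k + 1)) ^ 3" by (rule zero_less_power) simp
    then have n0: "real n \<noteq> 0" using n by linarith
    have q3: "q ^ 3 = real n" using n0 by (simp add: q_def powr_power)
    have q2: "q\<^sup>2 = real n powr (2 / 3)" using n0 by (simp add: q_def powr_power)
    have q2k: "q ^ (2 * k) = real n powr (2 * real k / 3)"
      using n0 by (simp add: q_def powr_power)
    have "(100 * \<kappa>) ^ 3 \<le> q ^ 3"
      using of_nat_mono[OF n, where 'a = real] unfolding q3 \<kappa>_def by (simp add: add.commute)
    then have q: "q \<ge> 100 * \<kappa>"
      using \<kappa> q0 by (subst (asm) power_mono_iff) auto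
    define t where "t = q\<^sup>2 / (68 * \<kappa>)"
    have qq: "100 * \<kappa> * (100 * \<kappa>) \<le> q\<^sup>2"
      unfolding power2_eq_square using q \<kappa> by (intro mult_mono) auto
    have "t \<ge> (100 * \<kappa> * (100 * \<kappa>)) / (68 * \<kappa>)"
      unfolding t_def using qq \<kappa> by (intro divide_right_mono) auto
    \<comment> \<open>This leaves \<open>t / 2\<close> dot products after \<open>k\<close> of them
      have been given up for injectivity.\<close>
    then have t: "t \<ge> 2 * \<kappa>" using \<kappa> by simp
    have tq: "t \<le> q\<^sup>2"
      unfolding t_def using \<kappa> mult_left_mono[of 1 "68 * \<kappa>" "q\<^sup>2"] by (simp add: field_simps)
    define rich where "rich S = {x \<in> S. t \<le> real (card (dots x S))}" for S :: "(real^2) set"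
    define A where "A i = (rich ^^ i) F" for i
    have A0: "A 0 = F" and AS: "A (Suc i) = rich (A i)" for i by (simp_all add: A_def)
    have dec: "decseq A" by (rule decseq_SucI) (auto simp: AS rich_def)
    have fA: "finite (A i)" for i
      using decseqD[OF dec, of 0 i] EF(2) unfolding A0 by (intro finite_subset[of "A i" F]) simp_all
    have half: "real n / 2 \<le> real n - real i * (real n / (2 * \<kappa>))" if "i \<le> k" for i
    proof -
      have "real i * real n \<le> \<kappa> * real n"
        using that by (intro mult_right_mono) (auto simp: \<kappa>_def)
      then show ?thesis using \<kappa> by (simp add: field_simps)
    qed
    have cA: "real (card (A i)) \<ge> real n - real i * (real n / (2 * \<kappa>))" if "i \<le> k" for i
      using that
    proof (induction i)
      case 0
      then show ?case using EF by (simp add: A0)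
    next
      case (Suc i)
      define B where "B = {x \<in> A i. real (card (dots x (A i))) < t}"
      have "real (card B) \<le> q ^ 3 / (2 * \<kappa>)"
      proof (rule card_bad_pins_le_fraction[OF fA[of i] _ \<kappa> q])
        show "finite B" using fA by (simp add: B_def)
        show "q ^ 3 / 2 \<le> real (card (A i))" using Suc half[of i] unfolding q3 by simp
        show "real (card (dots x (A i))) \<le> q\<^sup>2 / (68 * \<kappa>)" if "x \<in> B" for x
          using that by (simp add: B_def t_def)
        show "real (card (B \<inter> span {d})) \<le> q\<^sup>2" if "d \<noteq> 0" for d
          using card_bad_on_line_le[OF fA[of i], of t d] t tq \<kappa> unfolding B_def by linarith
      qed
      moreover have "A i = A (Suc i) \<union> B" by (auto simp: AS rich_def B_def)
      then have "card (A i) \<le> card (A (Suc i)) + card B" by (metis card_Un_le)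
      moreover have "real n - real i * (real n / (2 * \<kappa>)) \<le> real (card (A i))" using Suc by simp
      moreover have "real (Suc i) * (real n / (2 * \<kappa>)) = real n / (2 * \<kappa>) + real i * (real n / (2 * \<kappa>))"
        by (simp only: of_nat_Suc distrib_right mult_1)
      ultimately show ?case unfolding q3 by linarith
    qed
    \<comment> \<open>The pin has to be rich for every \<open>A i\<close> with \<open>i < k\<close>.
      These sets decrease, so richness for the smallest of them is enough.\<close>
    define G where "G = A (k - 1)"
    define E' where "E' = {x \<in> E. t \<le> real (card (dots x G))}"
    define B where "B = {x \<in> E. real (card (dots x G)) < t}"
    have fG: "finite G" unfolding G_def by (rule fA)
    have "real (card B) \<le> q ^ 3 / (2 * \<kappa>)"
    proof (rule card_bad_pins_le_fraction[OF fG _ \<kappa> q])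
      show "finite B" using EF by (simp add: B_def)
      show "q ^ 3 / 2 \<le> real (card G)" using cA[of "k - 1"] half[of "k - 1"] unfolding q3 G_def by simp
      show "real (card (dots x G)) \<le> q\<^sup>2 / (68 * \<kappa>)" if "x \<in> B" for x
        using that by (simp add: B_def t_def)
      show "real (card (B \<inter> span {d})) \<le> q\<^sup>2" if "d \<noteq> 0" for d
      proof -
        have "card (B \<inter> span {d}) \<le> card (E \<inter> span {d})"
          using EF by (intro card_mono) (auto simp: B_def)
        then show ?thesis using lines that unfolding q2 by (meson of_nat_mono order_trans)
      qed
    qed
    moreover have "E = E' \<union> B" by (auto simp: E'_def B_def)
    then have "n \<le> card E' + card B" using EF by (metis card_Un_le)
    ultimately have "real n / 2 \<le> real (card E')"
      using half[of 1] assms unfolding q3 by simp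
    moreover have "real n / 2 ^ k \<le> real n / 2"
      using assms power_increasing[of 1 k "2::real"] by (intro divide_left_mono) auto
    ultimately have "real (card E') \<ge> real n / 2 ^ k - 0" by linarith
    moreover have "real (card (pinned_weights V es v x F)) \<ge> c * real n powr (2 * real k / 3)" if x: "x \<in> E'" for x
    proof -
      have T: "rooted_tree v V (set es)" using tree by (intro rooted_tree_if_is_tree)
      have ck: "card (set es) = k" using tree by (simp add: distinct_card)
      have "(t / 2) ^ card (set es) \<le> real (card (weightings V (set es) v x (A 0)))"
      proof (rule card_weightings_ge[OF T, of 0 k])
        show "t / 2 + real k \<le> real (card (dots y (A i)))" if i: "i < k" and y: "y \<in> insert x (A (Suc i))" for i y
        proof -
          have "t \<le> real (card (dots y (A i)))"
          proof (cases "y \<in> A (Suc i)")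
            case True
            then show ?thesis by (simp add: AS rich_def)
          next
            case False
            have "G \<subseteq> A i" unfolding G_def using i by (intro decseqD[OF dec]) simp
            then have "card (dots x G) \<le> card (dots x (A i))"
              using fA by (intro card_mono image_mono) auto
            then show ?thesis using x y False by (simp add: E'_def)
          qed
          then show ?thesis using t by (simp add: \<kappa>_def)
        qed
      qed (use t \<kappa> dec fA ck in auto)
      moreover have "(t / 2) ^ k = c * q ^ (2 * k)"
        by (simp add: t_def c_def power_mult power_divide power_mult_distrib)
      ultimately show ?thesis
        unfolding card_pinned_weights[OF T] A0 ck q2k by simp
    qed
    moreover have "E' \<subseteq> E" by (auto simp: E'_def)
    ultimately show ?thesis by blast
  qed
  show ?thesis
  proof (rule exI[of _ c], intro conjI exI[of _ "\<lambda>_. 0"])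
    show "c > 0" using \<kappa> by (simp add: c_def)
    show "(\<lambda>_. 0) \<in> o(\<lambda>n. real n)" by simp
  qed (rule eventually_mono[OF eventually_ge_at_top[of "(100 * (k + 1)) ^ 3"]],
      intro allI impI, elim conjE, rule main; assumption)
qed

end
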